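(* Let $2\le m\le n$ and let $\mathbf a_1,\dots,\mathbf a_m\in\mathbb R^n$ be non-zero-variance vectors. Then $r_{\mathbf a_1\mathbf a_2\cdots\mathbf a_m}^2=0$ if and only if the zero-mean variables $\mathbf a_1-\mu_{\mathbf a_1}\mathbf 1,\ \dots,\ \mathbf a_m-\mu_{\mathbf a_m}\mathbf 1$ are pairwise perpendicular (orthogonal) to each other.
   Context: For $\mathbf a=(a_1,\dots,a_n)^T\in\mathbb R^n$ let $\mu_{\mathbf a}=\frac1n\sum_{i=1}^n a_i$ and let $\mathbf 1$ be the all-ones vector. The vector $\mathbf a-\mu_{\mathbf a}\mathbf 1$ is called the zero-mean variable of $\mathbf a$; $\mathbf a$ is a non-zero-variance vector if $\mathbf a-\mu_{\mathbf a}\mathbf 1\neq 0$. In that case its standardized vector is $\mathbf a'=\frac{\mathbf a-\mu_{\mathbf a}\mathbf 1}{\|\mathbf a-\mu_{\mathbf a}\mathbf 1\|}$ (Euclidean norm). For non-zero-variance vectors $\mathbf a_1,\dots,\mathbf a_m\in\mathbb R^n$ ($2\le m\le n$) with standardized vectors $\mathbf a_i'=(a'_{i1},\dots,a'_{in})^T$, and for $1\le j_1<\cdots<j_m\le n$, let $[\mathbf a'(m)\,|\,j_1,\dots,j_m]$ be the $m\times m$ matrix with $(i,k)$ entry $a'_{i j_k}$. The unsigned correlation coefficient $r_{\mathbf a_1\cdots\mathbf a_m}\ge 0$ is defined by $$r_{\mathbf a_1\cdots\mathbf a_m}^2=1-\sum_{1\le j_1<\cdots<j_m\le n}\bigl(\det[\mathbf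 a'(m)\,|\,j_1,\dots,j_m]\bigr)^2 .$$ *)

theory Defs
  imports "HOL-Analysis.Analysis"
begin

definition mean_vec :: "real ^ 'n \<Rightarrow> real" where
  "mean_vec a = (\<Sum>i\<in>UNIV. a $ i) / real CARD('n)"

definition zero_mean :: "real ^ 'n \<Rightarrow> real ^ 'n" where
  "zero_mean a = a - mean_vec a *\<^sub>R 1"

definition nonzero_variance :: "real ^ 'n \<Rightarrow> bool" where
  "nonzero_variance a \<longleftrightarrow> zero_mean a \<noteq> 0"

definition standardized :: "real ^ 'n \<Rightarrow> real ^ 'n" where
  "standardized a = zero_mean a /\<^sub>R norm (zero_mean a)"

text \<open>
  A finite linearly ordered index type is order isomorphic to \<open>{1..n}\<close>, so the index tuples
  \<open>j\<^sub>1 < \<dots> < j\<^sub>m\<close> are exactly the strictly monotone maps from the row index type to the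
  coordinate index type.
\<close>

definition std_minor ::
    "('m::{finite,linorder} \<Rightarrow> real ^ 'n::{finite,linorder}) \<Rightarrow> ('m \<Rightarrow> 'n) \<Rightarrow>
      real ^ 'm::{finite,linorder} ^ 'm::{finite,linorder}" where
  "std_minor a j = (\<chi> i k. standardized (a i) $ j k)"

text \<open>
  For non-zero-variance vectors the radicand is nonnegative: by Cauchy--Binet the sum is the Gram
  determinant of unit vectors, which Hadamard's inequality bounds by 1.  Hence \<open>sqrt\<close> gives the
  nonnegative number whose square is the radicand.
\<close>

definition unsigned_corr ::
    "('m::{finite,linorder} \<Rightarrow> real ^ 'n::{finite,linorder}) \<Rightarrow> real" where
  "unsigned_corr a = sqrt (1 - (\<Sum>j | strict_mono j. (det (std_minor a j))\<^sup>2))"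

end

(* By Cauchy--Binet the sum of squared minors of an orthonormal family is the Gram
   determinant 1.  Over the families of unit vectors the sum attains its maximum by compactness,
   and at a maximum with positive value the vectors are orthogonal: if v_i . v_k = c is nonzero,
   then replacing v_i by v_i - c v_k changes no minor, and renormalizing the new vector multiplies
   every squared minor by 1 / (1 - c^2) > 1.  So the maximum is 1 and is attained exactly at the
   orthonormal families. *)
theory Submission
  imports Defs
begin

section \<open>The Cauchy--Binet formula\<close>

text \<open>Listing the domain in increasing order, each map produces the sorted duplicate-free list
  of its range, and a finite set has only one such list.\<close>

lemma strict_mono_eq_if_range_eq:
  fixes f g :: "'a::{finite,linorder} \<Rightarrow> 'b::linorder"
  assumes "strict_mono f" "strict_mono g" "range f = range g"
  shows "f = g"
proof -
  let ?xs = "sorted_list_of_set (UNIV :: 'a set)"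
  have sorted: "sorted (map h ?xs)" "distinct (map h ?xs)"
    if h: "strict_mono h" for h :: "'a \<Rightarrow> 'b"
  proof -
    show "sorted (map h ?xs)"
      unfolding sorted_map
      by (rule sorted_wrt_mono_rel[OF _ sorted_sorted_list_of_set[of UNIV]])
        (simp add: strict_mono_less_eq[OF h])
    show "distinct (map h ?xs)"
      using strict_mono_imp_inj_on[OF h] by (simp add: distinct_map)
  qed
  have "map f ?xs = map g ?xs"
    using assms sorted by (intro sorted_distinct_set_unique) auto
  then show ?thesis
    by auto
qed

text \<open>The element \<open>x\<close> goes to the member of \<open>S\<close> of the same rank;
  \<open>card {y. y < x}\<close> is the rank counted from 0, as list indexing requires.\<close>

lemma obtain_strict_mono_on_finite_set:
  fixes S :: "'b::linorder set"
  assumes "finite S" "card S = CARD('a::{finite,linorder})"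
  obtains f :: "'a::{finite,linorder} \<Rightarrow> 'b" where "strict_mono f" "range f = S"
proof
  let ?xs = "sorted_list_of_set S"
  let ?f = "\<lambda>x::'a. ?xs ! card {y. y < x}"
  have less: "card {y. y < x} < length ?xs" for x :: 'a
    using assms by (auto intro!: psubset_card_mono)
  show sm: "strict_mono ?f"
  proof (rule strict_monoI)
    fix x y :: 'a assume "x < y"
    then have "card {z. z < x} < card {z. z < y}"
      by (intro psubset_card_mono) auto
    then show "?f x < ?f y"
      using strict_sorted_list_of_set[of S] less[of y] by (simp add: sorted_wrt_iff_nth_less)
  qed
  have "range ?f \<subseteq> S"
    using nth_mem[OF less] assms(1) by auto
  moreover have "card (range ?f) = card S"
    using assms(2) by (simp add: card_image strict_mono_imp_inj_on[OF sm])
  ultimately show "range ?f = S"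
    using assms(1) by (simp add: card_subset_eq)
qed

text \<open>Serves to group the injective index maps in Cauchy--Binet by range: \<open>j\<close>
  enumerates the range increasingly and \<open>p\<close> records the order in which the map visits
  it.\<close>

lemma bij_betw_strict_mono_permutes_inj:
  "bij_betw (\<lambda>(j, p). j \<circ> p)
     ({j :: 'a::{finite,linorder} \<Rightarrow> 'b::{finite,linorder}. strict_mono j} \<times> {p. p permutes UNIV})
     {f. inj f}"
proof (rule bij_betwI')
  fix x y :: "('a \<Rightarrow> 'b) \<times> ('a \<Rightarrow> 'a)"
  assume x: "x \<in> {j. strict_mono j} \<times> {p. p permutes UNIV}"
    and y: "y \<in> {j. strict_mono j} \<times> {p. p permutes UNIV}"
  obtain j p j' p' where xy: "x = (j, p)" "y = (j', p')" by fastforce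
  have "j = j' \<and> p = p'" if eq: "j \<circ> p = j' \<circ> p'"
  proof -
    have "range j = range (j \<circ> p)" "range j' = range (j' \<circ> p')"
      using x y xy by (simp_all only: image_comp[symmetric])
        (auto simp: permutes_surj)
    then have "j = j'"
      using x y xy eq by (intro strict_mono_eq_if_range_eq) auto
    moreover from this have "p = p'"
      using y xy eq by (auto simp: fun_eq_iff strict_mono_eq)
    ultimately show ?thesis by simp
  qed
  then show "((case x of (j, p) \<Rightarrow> j \<circ> p) = (case y of (j, p) \<Rightarrow> j \<circ> p)) = (x = y)"
    using xy by auto
next
  fix x :: "('a \<Rightarrow> 'b) \<times> ('a \<Rightarrow> 'a)"
  assume "x \<in> {j. strict_mono j} \<times> {p. p permutes UNIV}"
  then show "(case x of (j, p) \<Rightarrow> j \<circ> p) \<in> {f. inj f}"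
    by (auto simp del: comp_apply intro: inj_compose[OF strict_mono_imp_inj_on permutes_inj])
next
  fix f :: "'a \<Rightarrow> 'b" assume "f \<in> {f. inj f}"
  then have f: "inj f" by simp
  obtain j :: "'a \<Rightarrow> 'b" where j: "strict_mono j" "range j = range f"
    using obtain_strict_mono_on_finite_set[of "range f"] f by (metis card_image finite)
  \<comment> \<open>This sends \<open>i\<close> to the position of \<open>f i\<close> in the
    increasing enumeration; \<open>inv j\<close> is applied only to values in the range of
    \<open>j\<close>.\<close>
  let ?p = "inv j \<circ> f"
  have jp: "j \<circ> ?p = f"
    using j(2) by (auto simp: fun_eq_iff f_inv_into_f)
  then have "inj ?p"
    using f inj_on_imageI2[of j ?p UNIV] by simp
  then have "?p permutes UNIV"
    by (intro inj_imp_permutes) auto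
  then show "\<exists>x\<in>{j. strict_mono j} \<times> {p. p permutes UNIV}. f = (case x of (j, p) \<Rightarrow> j \<circ> p)"
    using j(1) jp by (intro bexI[of _ "(j, ?p)"]) auto
qed

text \<open>Multilinearity in the rows: row \<open>i\<close> of the product is a linear combination
  of the rows of \<open>B\<close>, and \<open>f\<close> records which of them is chosen for each
  \<open>i\<close>.\<close>

lemma det_matrix_mult_eq_sum_functions:
  fixes A :: "'a::comm_ring_1 ^ 'n::finite ^ 'm::finite" and B :: "'a ^ 'm ^ 'n"
  shows "det (A ** B) = (\<Sum>f\<in>UNIV. (\<Prod>i\<in>UNIV. A $ i $ f i) * det (\<chi> i. B $ f i))"
proof -
  have expand: "(\<Prod>i\<in>UNIV. (A ** B) $ i $ p i) =
      (\<Sum>f\<in>UNIV. (\<Prod>i\<in>UNIV. A $ i $ f i) * (\<Prod>i\<in>UNIV. B $ f i $ p i))" for p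
    using prod_sum_PiE[of UNIV "\<lambda>_. UNIV" "\<lambda>i k. A $ i $ k * B $ k $ p i"]
    by (simp add: matrix_matrix_mult_def prod.distrib)
  have "det (A ** B) = (\<Sum>p | p permutes UNIV. \<Sum>f\<in>UNIV.
      (\<Prod>i\<in>UNIV. A $ i $ f i) * (of_int (sign p) * (\<Prod>i\<in>UNIV. B $ f i $ p i)))"
    unfolding det_def expand by (simp add: sum_distrib_left mult_ac)
  also have "\<dots> = (\<Sum>f\<in>UNIV. (\<Prod>i\<in>UNIV. A $ i $ f i) * det (\<chi> i. B $ f i))"
    by (subst sum.swap) (simp add: det_def sum_distrib_left)
  finally show ?thesis .
qed

text \<open>A non-injective \<open>f\<close> repeats a row of \<open>B\<close> and contributes 0;
  the injective ones are written as \<open>j \<circ> p\<close> and summed over \<open>p\<close>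
  first.\<close>

theorem Cauchy_Binet:
  fixes A :: "'a::comm_ring_1 ^ 'n::{finite,linorder} ^ 'm::{finite,linorder}"
    and B :: "'a ^ 'm::{finite,linorder} ^ 'n::{finite,linorder}"
  shows "det (A ** B) =
    (\<Sum>j | strict_mono j. det (\<chi> i k. A $ i $ j k) * det (\<chi> i. B $ j i))"
proof -
  let ?g = "\<lambda>f. (\<Prod>i\<in>UNIV. A $ i $ f i) * det (\<chi> i. B $ f i)"
  have noninj: "?g f = 0" if "\<not> inj f" for f
  proof -
    from that obtain i k where "i \<noteq> k" "f i = f k" by (auto simp: inj_def)
    then have "det (\<chi> i. B $ f i) = 0"
      by (intro det_identical_rows[of i k]) (auto simp: row_def)
    then show ?thesis by simp
  qed
  have perm: "det (\<chi> i. B $ j (p i)) = of_int (sign p) * det (\<chi> i. B $ j i)"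
    if "p permutes UNIV" for j p
    using det_permute_rows[OF that, of "\<chi> i. B $ j i"] by simp
  have "det (A ** B) = (\<Sum>f | inj f. ?g f)"
    unfolding det_matrix_mult_eq_sum_functions
    using noninj by (intro sum.mono_neutral_right) auto
  also have "\<dots> = (\<Sum>(j, p)\<in>{j. strict_mono j} \<times> {p. p permutes UNIV}. ?g (j \<circ> p))"
    by (subst sum.reindex_bij_betw[OF bij_betw_strict_mono_permutes_inj, symmetric])
      (simp add: case_prod_unfold)
  also have "\<dots> = (\<Sum>j | strict_mono j. \<Sum>p | p permutes UNIV. ?g (j \<circ> p))"
    by (simp add: sum.cartesian_product)
  \<comment> \<open>Sorting the rows of \<open>B\<close> costs \<open>sign p\<close>, which turns
    the sum over \<open>p\<close> into the Leibniz formula for the minor of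
    \<open>A\<close>.\<close>
  also have "\<dots> = (\<Sum>j | strict_mono j. det (\<chi> i k. A $ i $ j k) * det (\<chi> i. B $ j i))"
    by (intro sum.cong refl)
      (simp add: perm det_def[of "\<chi> i k. A $ i $ j k" for j] sum_distrib_left mult_ac)
  finally show ?thesis .
qed

section \<open>Sums of squared maximal minors\<close>

text \<open>The Gram determinant of the rows, kept as a sum of minors so that it matches
  \<open>unsigned_corr\<close> and row operations can be followed minor by minor.\<close>

definition sum_sq_minors :: "real ^ 'n::{finite,linorder} ^ 'm::{finite,linorder} \<Rightarrow> real" where
  "sum_sq_minors V = (\<Sum>j | strict_mono j. (det (\<chi> i k. V $ i $ j k))\<^sup>2)"

lemma sum_sq_minors_eq_det: "sum_sq_minors V = det (V ** transpose V)"
proof -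
  have "det (\<chi> i. transpose V $ j i) = det (\<chi> i k. V $ i $ j k)" for j
    by (subst det_transpose[symmetric]) (simp add: transpose_def)
  then show ?thesis
    by (simp add: Cauchy_Binet sum_sq_minors_def power2_eq_square)
qed

text \<open>The Gram matrix is the identity. This fixes the maximal value at 1 once some maximizer
  is known to be orthonormal.\<close>

lemma sum_sq_minors_orthonormal:
  assumes "\<And>i. norm (V $ i) = 1" "\<And>i k. i \<noteq> k \<Longrightarrow> orthogonal (V $ i) (V $ k)"
  shows "sum_sq_minors V = 1"
proof -
  have "(V ** transpose V) $ i $ k = mat 1 $ i $ k" for i k
  proof -
    have "(V ** transpose V) $ i $ k = V $ i \<bullet> V $ k"
      by (simp add: matrix_matrix_mult_def transpose_def inner_vec_def)
    also have "\<dots> = mat 1 $ i $ k"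
      using assms by (auto simp: mat_def orthogonal_def norm_eq_1)
    finally show ?thesis .
  qed
  then have "V ** transpose V = mat 1" by (simp add: vec_eq_iff)
  then show ?thesis by (simp add: sum_sq_minors_eq_det)
qed

lemma continuous_on_sum_sq_minors: "continuous_on S sum_sq_minors"
  unfolding sum_sq_minors_def[abs_def] det_def by (intro continuous_intros)

text \<open>Selecting columns commutes with row operations, so each minor undergoes the same
  determinant-preserving operation.\<close>

lemma sum_sq_minors_add_row:
  assumes "i \<noteq> k"
  shows "sum_sq_minors (\<chi> l. if l = i then V $ i + c *\<^sub>R V $ k else V $ l) = sum_sq_minors V"
proof -
  have "det (\<chi> l h. (\<chi> l. if l = i then V $ i + c *\<^sub>R V $ k else V $ l) $ l $ j h) =
      det (\<chi> l h. V $ l $ j h)" for j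
    by (subst det_row_operation[OF assms, of "\<chi> l h. V $ l $ j h" c, symmetric])
      (rule arg_cong[where f = det], simp add: vec_eq_iff row_def)
  then show ?thesis by (simp add: sum_sq_minors_def)
qed

lemma sum_sq_minors_scale_row:
  "sum_sq_minors (\<chi> l. if l = i then c *\<^sub>R V $ i else V $ l) = c\<^sup>2 * sum_sq_minors V"
proof -
  have "det (\<chi> l h. (\<chi> l. if l = i then c *\<^sub>R V $ i else V $ l) $ l $ j h) =
      c * det (\<chi> l h. V $ l $ j h)" for j
  proof -
    have "det (\<chi> l. if l = i then c *s (\<chi> h. V $ l $ j h) else (\<chi> h. V $ l $ j h)) =
        c * det (\<chi> l h. V $ l $ j h)"
      by (simp add: det_row_mul)
    moreover have "(\<chi> l h. (\<chi> l. if l = i then c *\<^sub>R V $ i else V $ l) $ l $ j h) =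
        (\<chi> l. if l = i then c *s (\<chi> h. V $ l $ j h) else (\<chi> h. V $ l $ j h))"
      by (simp add: vec_eq_iff)
    ultimately show ?thesis by simp
  qed
  then show ?thesis by (simp add: sum_sq_minors_def power_mult_distrib sum_distrib_left)
qed

text \<open>One Gram--Schmidt step at row \<open>i\<close>, then renormalization. Positivity of the
  sum both excludes \<open>w = 0\<close> and makes the gain strict.\<close>

lemma sum_sq_minors_orthogonalize:
  fixes V :: "real ^ 'n::{finite,linorder} ^ 'm::{finite,linorder}"
  assumes unit: "\<And>i. norm (V $ i) = 1" and pos: "0 < sum_sq_minors V"
    and ik: "i \<noteq> k" "\<not> orthogonal (V $ i) (V $ k)"
  obtains W :: "real ^ 'n::{finite,linorder} ^ 'm::{finite,linorder}"
    where "\<And>i. norm (W $ i) = 1" "sum_sq_minors V < sum_sq_minors W"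
proof -
  define c where "c = V $ i \<bullet> V $ k"
  define w where "w = V $ i + (- c) *\<^sub>R V $ k"
  define U where "U = (\<chi> l. if l = i then w else V $ l)"
  define W where "W = (\<chi> l. if l = i then inverse (norm w) *\<^sub>R U $ i else U $ l)"
  have U: "sum_sq_minors U = sum_sq_minors V"
    unfolding U_def w_def by (rule sum_sq_minors_add_row[OF ik(1)])
  have W: "sum_sq_minors W = (inverse (norm w))\<^sup>2 * sum_sq_minors U"
    unfolding W_def by (rule sum_sq_minors_scale_row)
  have "w \<noteq> 0"
  proof
    assume "w = 0"
    \<comment> \<open>Row \<open>i\<close> of \<open>U\<close> would be zero, so scaling it by 0
      changes nothing, while the scaling rule makes the sum 0.\<close>
    then have "(\<chi> l. if l = i then 0 *\<^sub>R U $ i else U $ l) = U"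
      by (simp add: U_def vec_eq_iff)
    then show False
      using sum_sq_minors_scale_row[of i 0 U] U pos by simp
  qed
  have "V $ l \<bullet> V $ l = 1" for l using unit by (simp add: norm_eq_1)
  moreover have "V $ k \<bullet> V $ i = c" "V $ i \<bullet> V $ k = c"
    by (simp_all add: c_def inner_commute)
  \<comment> \<open>Pythagoras: \<open>w\<close> is the part of the unit vector \<open>V $ i\<close>
    perpendicular to the unit vector \<open>V $ k\<close>.\<close>
  ultimately have "w \<bullet> w = 1 - c\<^sup>2"
    by (simp add: w_def inner_diff_left inner_diff_right power2_eq_square)
  then have "(norm w)\<^sup>2 = 1 - c\<^sup>2" by (simp add: power2_norm_eq_inner)
  moreover have "c \<noteq> 0" using ik(2) by (simp add: c_def orthogonal_def)
  ultimately have "(norm w)\<^sup>2 < 1" by simp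
  moreover have "0 < (norm w)\<^sup>2" using \<open>w \<noteq> 0\<close> by simp
  ultimately have "1 < (inverse (norm w))\<^sup>2"
    by (simp add: power_inverse one_less_inverse)
  then have "sum_sq_minors V < sum_sq_minors W"
    using W U pos by simp
  moreover have "norm (W $ l) = 1" for l
    using unit \<open>w \<noteq> 0\<close> by (simp add: W_def U_def)
  ultimately show ?thesis using that by blast
qed

lemma compact_unit_rows: "compact {V :: real ^ 'n ^ 'm. \<forall>i. norm (V $ i) = 1}"
proof -
  have "bounded {V :: real ^ 'n ^ 'm. \<forall>i. norm (V $ i) = 1}"
    \<comment> \<open>The Euclidean norm of the row norms is at most their sum, which is the number
      of rows.\<close>
    by (rule boundedI[where B = "\<Sum>i\<in>(UNIV :: 'm set). 1"])
      (auto simp: norm_vec_def intro!: order.trans[OF L2_set_le_sum])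
  moreover have "closed {V :: real ^ 'n ^ 'm. \<forall>i. norm (V $ i) = 1}"
    by (intro closed_Collect_all closed_Collect_eq continuous_intros)
  ultimately show ?thesis by (simp add: compact_eq_bounded_closed)
qed

text \<open>The equality case of Hadamard's inequality for unit rows, obtained from a maximizer
  \<open>M\<close> on a compact set.\<close>

lemma sum_sq_minors_eq_1_iff:
  fixes V :: "real ^ 'n::{finite,linorder} ^ 'm::{finite,linorder}"
  assumes unit: "\<And>i. norm (V $ i) = 1"
  shows "sum_sq_minors V = 1 \<longleftrightarrow> (\<forall>i k. i \<noteq> k \<longrightarrow> orthogonal (V $ i) (V $ k))"
proof
  assume V: "sum_sq_minors V = 1"
  let ?S = "{V :: real ^ 'n::{finite,linorder} ^ 'm::{finite,linorder}. \<forall>i. norm (V $ i) = 1}"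
  have "\<exists>M\<in>?S. \<forall>W\<in>?S. sum_sq_minors W \<le> sum_sq_minors M"
    using unit by (intro continuous_attains_sup compact_unit_rows continuous_on_sum_sq_minors) auto
  then obtain M :: "real ^ 'n::{finite,linorder} ^ 'm::{finite,linorder}"
    where M: "\<And>i. norm (M $ i) = 1"
      and max: "\<And>W :: real ^ 'n::{finite,linorder} ^ 'm::{finite,linorder}.
        (\<And>i. norm (W $ i) = 1) \<Longrightarrow> sum_sq_minors W \<le> sum_sq_minors M"
    by blast
  \<comment> \<open>\<open>V\<close> itself competes with value 1, so the maximum is positive and a
    non-orthogonal pair of rows of \<open>M\<close> could be improved.\<close>
  have "0 < sum_sq_minors M" using max[OF unit] V by simp
  then have "orthogonal (M $ i) (M $ k)" if "i \<noteq> k" for i k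
    using sum_sq_minors_orthogonalize[OF M _ that] max by (metis not_le)
  then have "sum_sq_minors M = 1" using M by (intro sum_sq_minors_orthonormal)
  \<comment> \<open>The maximum is 1 and \<open>V\<close> attains it, so the same improvement
    argument applies to \<open>V\<close>.\<close>
  then show "\<forall>i k. i \<noteq> k \<longrightarrow> orthogonal (V $ i) (V $ k)"
    using sum_sq_minors_orthogonalize[OF unit] max V by (metis not_le zero_less_one)
qed (use unit sum_sq_minors_orthonormal in blast)

theorem mainTheorem2:
  fixes a :: "'m::{finite,linorder} \<Rightarrow> real ^ 'n::{finite,linorder}"
  assumes "2 \<le> CARD('m)" and "CARD('m) \<le> CARD('n)"
    and "\<And>i. nonzero_variance (a i)"
  shows "(unsigned_corr a)\<^sup>2 = 0 \<longleftrightarrow>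
    (\<forall>i j. i \<noteq> j \<longrightarrow> orthogonal (zero_mean (a i)) (zero_mean (a j)))"
proof -
  let ?V = "\<chi> i. standardized (a i)"
  have nz: "zero_mean (a i) \<noteq> 0" for i
    using assms(3) by (simp add: nonzero_variance_def)
  have "unsigned_corr a = sqrt (1 - sum_sq_minors ?V)"
    by (simp add: unsigned_corr_def std_minor_def sum_sq_minors_def)
  \<comment> \<open>In HOL \<open>sqrt x = 0\<close> holds exactly for \<open>x = 0\<close>, on all
    reals including the negative ones.\<close>
  then have "(unsigned_corr a)\<^sup>2 = 0 \<longleftrightarrow> sum_sq_minors ?V = 1"
    by auto
  also have "\<dots> \<longleftrightarrow> (\<forall>i j. i \<noteq> j \<longrightarrow> orthogonal (standardized (a i)) (standardized (a j)))"
    using nz by (subst sum_sq_minors_eq_1_iff) (auto simp: standardized_def)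
  \<comment> \<open>Dividing by the nonzero norms only rescales the inner products.\<close>
  also have "\<dots> \<longleftrightarrow> (\<forall>i j. i \<noteq> j \<longrightarrow> orthogonal (zero_mean (a i)) (zero_mean (a j)))"
    using nz by (simp add: standardized_def orthogonal_def)
  finally show ?thesis .
qed

end
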